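(* Let $M,N$ be positive integers and let $\Phi = \{\phi_n\}_{n=1}^N \subset \mathbb{C}^M$ be a complex frame. Write $\phi_n = u_n + \mathrm{i} v_n$ with $u_n, v_n \in \mathbb{R}^M$, and let $U$ (resp. $V$) be the real $M\times N$ matrix with columns $u_n$ (resp. $v_n$). Then the map $\mathcal{A}_\Phi$ is injective if and only if $[U,V]$ does not belong to the projection $\pi_1\bigl((\mathcal{B}_{M,N})_{\mathbb{R}}\bigr)$.
   Context: $\mathbb{C}^M$ carries the inner product $\langle x, y\rangle = \sum_{m=1}^M x_m \overline{y_m}$. An $N$-element complex frame is a collection of vectors $\phi_1,\dots,\phi_N$ that span $\mathbb{C}^M$. The map $\mathcal{A}_\Phi \colon (\mathbb{C}^M/S^1) \to (\mathbb{R}_{\geq 0})^N$ is $x \mapsto (|\langle x, \phi_n\rangle|^2)_{n=1,\dots,N}$, where $\mathbb{C}^M/S^1$ is obtained by identifying $x$ with $e^{\mathrm{i}\theta}x$ for every real $\theta$. Let $\mathbb{C}^{M\times M}_{\mathrm{sym}}$ and $\mathbb{C}^{M\times M}_{\mathrm{skew}}$ denote the spaces of symmetric and skew-symmetric complex $M\times M$ matrices. $\mathcal{B}_{M,N}$ is the subvariety of $\mathbb{P}(\mathbb{C}^{M\times N}\times\mathbb{C}^{M\times N})\times\mathbb{P}(\mathbb{C}^{M\times M}_{\mathrm{sym}}\times\mathbb{C}^{M\times M}_{\mathrm{skew}})$ consisting of the points $([U,V],[X,Y])$ for which $$\operatorname{rank}(X+\mathrm{i}Y)\leq 2 \quad\text{and}\quad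 u_n^TXu_n + v_n^TXv_n - 2u_n^TYv_n = 0 \ \text{ for all } 1\leq n\leq N,$$ where $u_n$ and $v_n$ are the $n$th columns of $U$ and $V$. $(\mathcal{B}_{M,N})_{\mathbb{R}}$ denotes its set of real points, i.e. the points $([U,V],[X,Y])$ of $\mathcal{B}_{M,N}$ that can be represented with $U,V,X,Y$ all real matrices. $\pi_1$ is the projection of the product onto its first factor $\mathbb{P}(\mathbb{C}^{M\times N}\times\mathbb{C}^{M\times N})$. *)

theory Defs
  imports "HOL-Analysis.Analysis"
begin

subsection \<open>Phase retrieval with complex frames\<close>

text \<open>
  The index types \<open>'m\<close> and \<open>'n\<close> play the roles of \<open>{1..M}\<close> and \<open>{1..N}\<close>; they are
  finite and nonempty, so \<open>M\<close> and \<open>N\<close> are arbitrary positive integers.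
\<close>

definition cinner :: "complex ^ 'm \<Rightarrow> complex ^ 'm \<Rightarrow> complex" where
  "cinner x y = (\<Sum>m\<in>UNIV. x $ m * cnj (y $ m))"

text \<open>Here \<open>vec.span\<close> is the span over \<open>\<complex>\<close>; the plain \<open>span\<close> would be the span over \<open>\<real>\<close>.\<close>

definition complex_frame :: "('n::finite \<Rightarrow> complex ^ 'm) \<Rightarrow> bool" where
  "complex_frame \<phi> \<longleftrightarrow> vec.span (range \<phi>) = UNIV"

definition phase_rel :: "complex ^ 'm \<Rightarrow> complex ^ 'm \<Rightarrow> bool" where
  "phase_rel x y \<longleftrightarrow> (\<exists>\<theta>::real. y = exp (\<i> * complex_of_real \<theta>) *s x)"

lemma equivp_phase_rel: "equivp (phase_rel :: complex ^ 'm \<Rightarrow> complex ^ 'm \<Rightarrow> bool)"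
proof (rule equivpI)
  show "reflp (phase_rel :: complex ^ 'm \<Rightarrow> complex ^ 'm \<Rightarrow> bool)"
    by (rule reflpI) (auto simp: phase_rel_def intro!: exI[of _ 0])
  show "symp (phase_rel :: complex ^ 'm \<Rightarrow> complex ^ 'm \<Rightarrow> bool)"
  proof (rule sympI)
    fix x y :: "complex ^ 'm"
    assume "phase_rel x y"
    then obtain t :: real where "y = exp (\<i> * complex_of_real t) *s x"
      by (auto simp: phase_rel_def)
    then have "x = exp (\<i> * complex_of_real (- t)) *s y"
      by (simp add: vector_smult_assoc flip: exp_add)
    then show "phase_rel y x"
      unfolding phase_rel_def by blast
  qed
  show "transp (phase_rel :: complex ^ 'm \<Rightarrow> complex ^ 'm \<Rightarrow> bool)"
  proof (rule transpI)
    fix x y z :: "complex ^ 'm"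
    assume "phase_rel x y" "phase_rel y z"
    then obtain s t :: real where "y = exp (\<i> * complex_of_real s) *s x"
      "z = exp (\<i> * complex_of_real t) *s y"
      unfolding phase_rel_def by blast
    then have "z = exp (\<i> * complex_of_real (t + s)) *s x"
      by (simp add: vector_smult_assoc ring_distribs flip: exp_add)
    then show "phase_rel x z"
      unfolding phase_rel_def by blast
  qed
qed

text \<open>The quotient of \<open>\<complex>\<^sup>M\<close> by the action of \<open>S\<^sup>1\<close>.\<close>

quotient_type 'm mod_phase = "complex ^ ('m::finite)" / phase_rel
  by (rule equivp_phase_rel)

lift_definition intensity_map :: "('n::finite \<Rightarrow> complex ^ 'm) \<Rightarrow> 'm::finite mod_phase \<Rightarrow> real ^ 'n"
  is "\<lambda>\<phi> x. \<chi> n. (cmod (cinner x (\<phi> n)))\<^sup>2"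
proof -
  fix \<phi> :: "'n \<Rightarrow> complex ^ 'm" and x y :: "complex ^ 'm"
  assume "phase_rel x y"
  then obtain t :: real where y: "y = exp (\<i> * complex_of_real t) *s x"
    by (auto simp: phase_rel_def)
  have "cinner y w = exp (\<i> * complex_of_real t) * cinner x w" for w
    by (simp add: y cinner_def sum_distrib_left mult.assoc)
  then show "(\<chi> n. (cmod (cinner x (\<phi> n)))\<^sup>2) = (\<chi> n. (cmod (cinner y (\<phi> n)))\<^sup>2)"
    by (simp add: norm_mult)
qed

subsection \<open>Projective spaces of pairs of complex matrices\<close>

type_synonym ('m, 'k) cmat_pair = "(complex ^ 'k ^ 'm) \<times> (complex ^ 'k ^ 'm)"

definition pair_scale :: "complex \<Rightarrow> ('m::finite, 'k::finite) cmat_pair \<Rightarrow> ('m, 'k) cmat_pair" where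
  "pair_scale c p = (map_matrix ((*) c) (fst p), map_matrix ((*) c) (snd p))"

definition proj_pt :: "('m::finite, 'k::finite) cmat_pair \<Rightarrow> ('m, 'k) cmat_pair set" where
  "proj_pt p = {pair_scale c p | c. c \<noteq> 0}"

definition proj_space :: "('m::finite, 'k::finite) cmat_pair set \<Rightarrow> ('m, 'k) cmat_pair set set" where
  "proj_space W = proj_pt ` (W - {0})"

definition sym_mats :: "(complex ^ 'm ^ 'm) set" where
  "sym_mats = {X. transpose X = X}"

definition skew_mats :: "(complex ^ 'm ^ 'm) set" where
  "skew_mats = {Y. transpose Y = - Y}"

subsection \<open>The incidence variety\<close>

text \<open>
  The product \<open>scalar_product\<close> is the bilinear one (no conjugation), so that
  \<open>scalar_product u (X *v v)\<close> is \<open>u\<^sup>T X v\<close>.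
\<close>

definition BMN_eqs :: "('m::finite, 'n::finite) cmat_pair \<Rightarrow> ('m, 'm) cmat_pair \<Rightarrow> bool" where
  "BMN_eqs = (\<lambda>(U, V) (X, Y).
     rank (X + map_matrix ((*) \<i>) Y) \<le> 2 \<and>
     (\<forall>n. scalar_product (column n U) (X *v column n U)
        + scalar_product (column n V) (X *v column n V)
        - 2 * scalar_product (column n U) (Y *v column n V) = 0))"

definition BMN :: "(('m::finite, 'n::finite) cmat_pair set \<times> ('m, 'm) cmat_pair set) set" where
  "BMN = {(P, Q) \<in> proj_space UNIV \<times> proj_space (sym_mats \<times> skew_mats).
            \<exists>p\<in>P. \<exists>q\<in>Q. BMN_eqs p q}"

definition real_pairs :: "('m::finite, 'k::finite) cmat_pair set" where
  "real_pairs = range (map_prod (map_matrix complex_of_real) (map_matrix complex_of_real))"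

definition BMN_real :: "(('m::finite, 'n::finite) cmat_pair set \<times> ('m, 'm) cmat_pair set) set" where
  "BMN_real = {(P, Q) \<in> BMN. \<exists>p\<in>real_pairs. \<exists>q\<in>real_pairs. P = proj_pt p \<and> Q = proj_pt q}"

text \<open>The defining conditions do not depend on the chosen representatives.\<close>

lemma BMN_eqs_scale:
  fixes p :: "('m::finite, 'n::finite) cmat_pair"
  assumes "c \<noteq> 0" "d \<noteq> 0"
  shows "BMN_eqs (pair_scale c p) (pair_scale d q) \<longleftrightarrow> BMN_eqs p q"
proof -
  obtain U V X Y where pq: "p = (U, V)" "q = (X, Y)"
    by (cases p, cases q)
  let ?Z = "X + map_matrix ((*) \<i>) Y"
  have eq: "map_matrix ((*) d) X + map_matrix ((*) \<i>) (map_matrix ((*) d) Y) = map_matrix ((*) d) ?Z"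
    by (simp add: vec_eq_iff algebra_simps)
  have "rows (map_matrix ((*) d) ?Z) = (\<lambda>x. d *s x) ` rows ?Z"
  proof -
    have "row i (map_matrix ((*) d) ?Z) = d *s row i ?Z" for i
      by (simp add: row_def vec_eq_iff)
    then show ?thesis
      unfolding rows_def by (auto simp: image_def)
  qed
  moreover have "finite (rows ?Z)"
    by (simp add: rows_def full_SetCompr_eq)
  ultimately have rank: "rank (map_matrix ((*) d) ?Z) = rank ?Z"
    using vec.span_image_scale[of "rows ?Z" "\<lambda>_. d"] assms
      vec.dim_span[of "rows ?Z"] vec.dim_span[of "rows (map_matrix ((*) d) ?Z)"]
    by (simp add: row_rank_def_gen)
  have col: "column n (map_matrix ((*) c) A) = c *s column n A" for n and A :: "complex ^ 'n ^ 'm"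
    by (simp add: column_def vec_eq_iff)
  have sp: "scalar_product (c *s u) (map_matrix ((*) d) A *v (c *s w))
      = c\<^sup>2 * d * scalar_product u (A *v w)" for u w :: "complex ^ 'm" and A
  proof -
    have "map_matrix ((*) d) A *v (c *s w) = (d * c) *s (A *v w)"
      by (simp add: vec_eq_iff matrix_vector_mult_def sum_distrib_left mult_ac)
    then show ?thesis
      by (simp add: scalar_product_def sum_distrib_left power2_eq_square mult_ac)
  qed
  have "c\<^sup>2 * d * a + c\<^sup>2 * d * b - 2 * (c\<^sup>2 * d * e) = 0 \<longleftrightarrow> a + b - 2 * e = 0" for a b e
  proof -
    have "c\<^sup>2 * d * a + c\<^sup>2 * d * b - 2 * (c\<^sup>2 * d * e) = c\<^sup>2 * d * (a + b - 2 * e)"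
      by (simp add: algebra_simps)
    then show ?thesis
      using assms by simp
  qed
  then show ?thesis
    by (simp add: BMN_eqs_def pair_scale_def pq eq rank col sp)
qed

lemma BMN_iff:
  fixes p :: "('m::finite, 'n::finite) cmat_pair"
  assumes "p \<noteq> 0" "q \<noteq> 0" "q \<in> sym_mats \<times> skew_mats"
  shows "(proj_pt p, proj_pt q) \<in> BMN \<longleftrightarrow> BMN_eqs p q"
proof -
  have one: "pair_scale 1 x = x" for x :: "('c::finite, 'd::finite) cmat_pair"
    by (simp add: pair_scale_def prod_eq_iff vec_eq_iff)
  have self: "x \<in> proj_pt x" for x :: "('c::finite, 'd::finite) cmat_pair"
    unfolding proj_pt_def mem_Collect_eq by (intro exI[of _ 1] conjI one[symmetric] one_neq_zero)
  have "(\<exists>p'\<in>proj_pt p. \<exists>q'\<in>proj_pt q. BMN_eqs p' q') \<longleftrightarrow> BMN_eqs p q"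
  proof
    assume "\<exists>p'\<in>proj_pt p. \<exists>q'\<in>proj_pt q. BMN_eqs p' q'"
    then obtain p' q' where p': "p' \<in> proj_pt p" and q': "q' \<in> proj_pt q" and *: "BMN_eqs p' q'"
      by (elim bexE)
    from p' obtain c where c: "p' = pair_scale c p" "c \<noteq> 0"
      unfolding proj_pt_def mem_Collect_eq by (elim exE conjE)
    from q' obtain d where d: "q' = pair_scale d q" "d \<noteq> 0"
      unfolding proj_pt_def mem_Collect_eq by (elim exE conjE)
    show "BMN_eqs p q"
      using * unfolding c(1) d(1) BMN_eqs_scale[OF c(2) d(2)] .
  next
    assume "BMN_eqs p q"
    then show "\<exists>p'\<in>proj_pt p. \<exists>q'\<in>proj_pt q. BMN_eqs p' q'"
      by (intro bexI[OF _ self])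
  qed
  moreover have "proj_pt p \<in> proj_space UNIV"
    unfolding proj_space_def using assms(1) by (intro imageI) simp
  moreover have "proj_pt q \<in> proj_space (sym_mats \<times> skew_mats)"
    unfolding proj_space_def using assms(2,3) by (intro imageI) simp
  ultimately show ?thesis
    by (simp only: BMN_def mem_Collect_eq case_prod_conv mem_Sigma_iff simp_thms)
qed

end

(* With Q = X + iY, real pairs (X, Y) with X symmetric and Y skew correspond to Hermitian
   matrices Q, and the equations of the incidence variety say phi_n^* Q phi_n = 0. If x and y have
   the same intensities, then Q = x x^* - y y^* satisfies these equations and has rank at most 2.
   Conversely a Hermitian Q of rank at most 2 is a x x^* + b y y^* with a, b real. If a and b have
   the same sign, the frame property forces Q = 0; otherwise, after absorbing sqrt |a| and
   sqrt |b| into the vectors, Q is up to sign x x^* - y y^* with x and y of equal intensities. *)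

theory Submission
  imports Defs
begin

section \<open>Hermitian matrices\<close>

definition hermitian :: "complex ^ 'm ^ 'm \<Rightarrow> bool" where
  "hermitian Q \<longleftrightarrow> (\<forall>i j. Q $ j $ i = cnj (Q $ i $ j))"

text \<open>The lift \<open>x x^*\<close>: intensities, which are quadratic in \<open>x\<close>,
  become linear in this matrix.\<close>

definition outer :: "complex ^ 'm \<Rightarrow> complex ^ 'm ^ 'm" where
  "outer x = (\<chi> i j. x $ i * cnj (x $ j))"

text \<open>The value \<open>z^* Q z\<close>, complex by type and real for Hermitian
  \<open>Q\<close>.\<close>

definition hform :: "complex ^ 'm ^ 'm \<Rightarrow> complex ^ ('m::finite) \<Rightarrow> complex" where
  "hform Q z = cinner (Q *v z) z"

section \<open>The inner product and orthogonality to a frame\<close>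

lemma cinner_add: "cinner (x + y) z = cinner x z + cinner y z"
  "cinner z (x + y) = cinner z x + cinner z y"
  by (simp_all add: cinner_def algebra_simps sum.distrib)

lemma cinner_commute: "cinner y x = cnj (cinner x y)"
  by (simp add: cinner_def mult.commute)

lemma cinner_self: "cinner x x = complex_of_real (\<Sum>i\<in>UNIV. (cmod (x $ i))\<^sup>2)"
  unfolding cinner_def of_real_sum by (intro sum.cong refl) (simp only: complex_norm_square)

lemma cinner_self_eq_0_iff:
  fixes x :: "complex ^ 'm::finite"
  shows "cinner x x = 0 \<longleftrightarrow> x = 0"
  unfolding cinner_self of_real_eq_0_iff
  by (subst sum_nonneg_eq_0_iff) (auto simp: vec_eq_iff)

text \<open>The vectors orthogonal to \<open>x\<close> form a complex subspace. Containing the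
  frame, it is the whole space, so \<open>x\<close> is orthogonal to itself.\<close>

lemma cinner_eq_0_on_frame:
  assumes "complex_frame \<phi>" and "\<And>n. cinner x (\<phi> n) = 0"
  shows "x = 0"
proof -
  have "cinner x (c *s z) = cnj c * cinner x z" for c z
    by (simp add: cinner_def sum_distrib_left mult_ac)
  then have "vec.subspace {z. cinner x z = 0}"
    by (simp add: vec.subspace_def cinner_add) (simp add: cinner_def)
  moreover have "range \<phi> \<subseteq> {z. cinner x z = 0}"
    using assms(2) by auto
  ultimately have "vec.span (range \<phi>) \<subseteq> {z. cinner x z = 0}"
    by (rule vec.span_minimal[rotated])
  then have "cinner x x = 0"
    using assms(1) unfolding complex_frame_def by auto
  then show ?thesis
    by (simp add: cinner_self_eq_0_iff)
qed

section \<open>Hermitian matrices and their forms\<close>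

lemma hermitian_outer: "hermitian (outer x)"
  by (simp add: hermitian_def outer_def)

lemma hermitian_diff: "hermitian A \<Longrightarrow> hermitian B \<Longrightarrow> hermitian (A - B)"
  unfolding hermitian_def by (metis complex_cnj_diff vector_minus_component)

lemma hermitian_scaleR: "hermitian A \<Longrightarrow> hermitian (c *\<^sub>R A)"
  unfolding hermitian_def by (metis complex_cnj_scaleR vector_scaleR_component)

lemma hermitian_cinner:
  assumes "hermitian Q"
  shows "cinner (Q *v x) y = cinner x (Q *v y)"
proof -
  have Q: "Q $ i $ j = cnj (Q $ j $ i)" for i j
    using assms unfolding hermitian_def by blast
  have "cinner (Q *v x) y = (\<Sum>i\<in>UNIV. \<Sum>j\<in>UNIV. Q $ i $ j * x $ j * cnj (y $ i))"
    by (simp add: cinner_def matrix_vector_mult_def sum_distrib_right)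
  also have "\<dots> = (\<Sum>j\<in>UNIV. \<Sum>i\<in>UNIV. Q $ i $ j * x $ j * cnj (y $ i))"
    by (rule sum.swap)
  also have "\<dots> = (\<Sum>j\<in>UNIV. \<Sum>i\<in>UNIV. x $ j * cnj (Q $ j $ i * y $ i))"
    by (subst Q) (simp add: mult_ac)
  also have "\<dots> = cinner x (Q *v y)"
    by (simp add: cinner_def matrix_vector_mult_def sum_distrib_left)
  finally show ?thesis .
qed

text \<open>Self-adjointness makes the value its own conjugate. The pivot of the Lagrange step is
  therefore real, and so is the coefficient of the rank-one term it splits off.\<close>

lemma hform_real:
  assumes "hermitian Q"
  shows "hform Q z = complex_of_real (Re (hform Q z))"
proof -
  have "hform Q z = cinner z (Q *v z)"
    by (simp add: hform_def hermitian_cinner[OF assms])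
  also have "\<dots> = cnj (hform Q z)"
    unfolding hform_def by (rule cinner_commute)
  finally show ?thesis
    by (simp add: complex_eq_iff)
qed

lemma hform_add: "hform (A + B) z = hform A z + hform B z"
  by (simp add: hform_def matrix_vector_mult_add_rdistrib cinner_add)

lemma hform_diff: "hform (A - B) z = hform A z - hform B z"
  using hform_add[of "A - B" B z] by simp

lemma hform_scaleR: "hform (c *\<^sub>R A) z = complex_of_real c * hform A z"
  by (simp add: hform_def cinner_def matrix_vector_mult_def sum_distrib_left sum_distrib_right
      scaleR_conv_of_real[where 'a = complex] mult.assoc)

lemma outer_mult_vec: "outer x *v z = cinner z x *s x"
  by (simp add: vec_eq_iff outer_def matrix_vector_mult_def cinner_def sum_distrib_left mult_ac)

text \<open>At a frame vector this is an intensity of \<open>x\<close>, which is how the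
  measurements enter the matrix picture.\<close>

lemma hform_outer: "hform (outer x) z = complex_of_real ((cmod (cinner x z))\<^sup>2)"
proof -
  have "hform (outer x) z = cinner z x * cinner x z"
    by (simp add: hform_def outer_mult_vec) (simp add: cinner_def sum_distrib_left mult.assoc)
  then show ?thesis
    by (simp only: cinner_commute[of z x] complex_norm_square mult.commute)
qed

lemma outer_scaleR: "outer (c *\<^sub>R x) = c\<^sup>2 *\<^sub>R outer x"
  by (simp add: outer_def vec_eq_iff scaleR_conv_of_real[where 'a = complex] power2_eq_square mult_ac)

text \<open>Polarization, in the form \<open>h(Qz + z) - h(Qz) - h(z) = 2 \<parallel>Qz\<parallel>\<^sup>2\<close>.\<close>

lemma hermitian_eq_0I:
  assumes "hermitian Q" and "\<And>z. hform Q z = 0"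
  shows "Q = 0"
proof -
  have "Q *v z = 0" for z
  proof -
    let ?w = "Q *v z"
    have "0 = hform Q (?w + z)"
      using assms by simp
    also have "\<dots> = hform Q ?w + hform Q z + cinner (Q *v ?w) z + cinner ?w ?w"
      by (simp add: hform_def matrix_vector_right_distrib cinner_add)
    \<comment> \<open>By self-adjointness the cross term \<open>cinner (Q *v ?w) z\<close> also
      equals \<open>cinner ?w ?w\<close>, because \<open>Q *v z\<close> is
      \<open>?w\<close>.\<close>
    also have "\<dots> = 2 * cinner ?w ?w"
      using assms by (simp add: hermitian_cinner)
    finally show ?thesis
      by (simp add: cinner_self_eq_0_iff)
  qed
  then show ?thesis
    by (simp add: matrix_eq)
qed

text \<open>One step of Lagrange's reduction of a Hermitian form.\<close>

lemma hermitian_rank_reduce: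
  fixes Q :: "complex ^ 'm ^ ('m::finite)"
  assumes "hermitian Q" "Q \<noteq> 0"
  obtains c x where "hermitian (Q - c *\<^sub>R outer x)" "rank (Q - c *\<^sub>R outer x) < rank Q"
proof -
  obtain w where w: "hform Q w \<noteq> 0"
    using hermitian_eq_0I assms by blast
  define \<alpha> where "\<alpha> = Re (hform Q w)"
  have \<alpha>: "hform Q w = complex_of_real \<alpha>"
    using hform_real[OF assms(1)] by (simp add: \<alpha>_def)
  then have \<alpha>0: "\<alpha> \<noteq> 0"
    using w by auto
  define x where "x = Q *v w"
  \<comment> \<open>The coefficient \<open>1/\<alpha>\<close> puts \<open>w\<close> in the kernel of
    \<open>Q'\<close>: \<open>outer x *v w\<close> is \<open>\<alpha>\<close> times
    \<open>x\<close>, since \<open>cinner w x\<close> equals \<open>hform Q w\<close>.\<close>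
  define Q' where "Q' = Q - (1/\<alpha>) *\<^sub>R outer x"
  \<comment> \<open>This is the row \<open>w^* Q\<close>, equal to \<open>x^*\<close> because
    \<open>Q\<close> is Hermitian. It lies in the row space of \<open>Q\<close> but, as shown below,
    not in that of \<open>Q'\<close>, so the rank drops strictly.\<close>
  define r where "r = (\<Sum>i\<in>UNIV. cnj (w $ i) *s row i Q)"
  have r_nth: "r $ j = cnj (x $ j)" for j
  proof -
    have "Q $ i $ j = cnj (Q $ j $ i)" for i
      using assms(1) unfolding hermitian_def by blast
    then show ?thesis
      by (simp add: r_def x_def row_def matrix_vector_mult_def mult.commute)
  qed
  have r_span: "r \<in> vec.span (rows Q)"
    unfolding r_def
    by (intro vec.span_sum vec.span_scale vec.span_base) (auto simp: rows_def)
  have "row i Q' = row i Q - (x $ i / complex_of_real \<alpha>) *s r" for i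
    by (simp add: vec_eq_iff row_def Q'_def outer_def r_nth scaleR_conv_of_real[where 'a = complex])
  moreover have "row i Q - (x $ i / complex_of_real \<alpha>) *s r \<in> vec.span (rows Q)" for i
    by (intro vec.span_diff vec.span_scale r_span vec.span_base) (auto simp: rows_def)
  ultimately have sub: "vec.span (rows Q') \<subseteq> vec.span (rows Q)"
    by (intro vec.span_minimal) (auto simp: rows_def)
  have cwx: "cinner w x = complex_of_real \<alpha>"
    using \<alpha> by (simp add: hform_def x_def hermitian_cinner[OF assms(1)])
  have "((1/\<alpha>) *\<^sub>R outer x) *v w = (1/\<alpha>) *\<^sub>R (outer x *v w)"
    by (simp add: vec_eq_iff matrix_vector_mult_def scaleR_sum_right)
  then have "Q' *v w = x - (1/\<alpha>) *\<^sub>R (outer x *v w)"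
    by (simp add: Q'_def x_def matrix_vector_mult_diff_rdistrib)
  also have "\<dots> = 0"
    using \<alpha>0 by (simp add: outer_mult_vec cwx vec_eq_iff scaleR_conv_of_real[where 'a = complex])
  finally have Q'w: "Q' *v w = 0" .
  \<comment> \<open>Being annihilated by \<open>w\<close> is a linear condition met by all rows of
    \<open>Q'\<close>, whereas \<open>r\<close> pairs with \<open>w\<close> to give the nonzero
    number \<open>\<alpha>\<close>.\<close>
  have "rows Q' \<subseteq> {z. scalar_product z w = 0}"
    using Q'w by (auto simp: rows_def row_def scalar_product_def matrix_vector_mult_def vec_eq_iff)
  moreover have "scalar_product (c *s z) w = c * scalar_product z w" for c z
    by (simp add: scalar_product_def sum_distrib_left mult.assoc)
  then have "vec.subspace {z. scalar_product z w = 0}"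
    by (simp add: vec.subspace_def) (simp add: scalar_product_def distrib_right sum.distrib)
  ultimately have "vec.span (rows Q') \<subseteq> {z. scalar_product z w = 0}"
    by (rule vec.span_minimal)
  moreover have "scalar_product r w = complex_of_real \<alpha>"
    using cwx by (simp add: scalar_product_def r_nth cinner_def mult.commute)
  ultimately have "r \<notin> vec.span (rows Q')"
    using \<alpha>0 by auto
  then have "rank Q' < rank Q"
    unfolding row_rank_def_gen using sub r_span by (intro vec.dim_psubset) blast
  moreover have "hermitian Q'"
    unfolding Q'_def by (intro hermitian_diff hermitian_scaleR hermitian_outer assms)
  ultimately show ?thesis
    using that unfolding Q'_def by blast
qed

section \<open>Matrices of low rank and rank-one matrices\<close>

lemma rank_eq_0_field: "rank A = 0 \<longleftrightarrow> A = 0" for A :: "'a::field ^ 'n ^ 'm"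
proof -
  have "rank A = 0 \<longleftrightarrow> (\<forall>i. row i A = 0)"
    by (auto simp: row_rank_def_gen rows_def)
  then show ?thesis
    by (simp add: row_def vec_eq_iff)
qed

text \<open>Each Lagrange step lowers the bound on the rank by one, so after two steps the remainder
  is zero.\<close>

lemma hermitian_rank_le_2:
  fixes Q :: "complex ^ 'm ^ ('m::finite)"
  assumes "hermitian Q" "rank Q \<le> 2"
  obtains a b x y where "Q = a *\<^sub>R outer x + b *\<^sub>R outer y"
proof -
  have step: "\<exists>c x. hermitian (A - c *\<^sub>R outer x) \<and> rank (A - c *\<^sub>R outer x) \<le> k"
    if "hermitian A" "rank A \<le> Suc k" for A :: "complex ^ 'm ^ 'm" and k
  proof (cases "A = 0")
    \<comment> \<open>A zero matrix offers no pivot; the coefficient 0 passes it on unchanged, which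
      covers ranks below the bound.\<close>
    case True
    then show ?thesis
      using that rank_eq_0_field[of A] by (intro exI[of _ 0]) simp
  next
    case False
    then show ?thesis
      using hermitian_rank_reduce[OF that(1)] that(2) by (metis less_Suc_eq_le order_less_le_trans)
  qed
  obtain a x where "hermitian (Q - a *\<^sub>R outer x)" "rank (Q - a *\<^sub>R outer x) \<le> Suc 0"
    using step[OF assms(1), of "Suc 0"] assms(2) by (auto simp: numeral_2_eq_2)
  then obtain b y where "rank (Q - a *\<^sub>R outer x - b *\<^sub>R outer y) \<le> 0"
    using step by blast
  then have "Q = a *\<^sub>R outer x + b *\<^sub>R outer y"
    by (simp add: rank_eq_0_field algebra_simps)
  then show ?thesis
    using that by blast
qed

text \<open>Every row is a combination of the entrywise conjugates of \<open>x\<close> and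
  \<open>y\<close>.\<close>

lemma rank_outer_diff_le: "rank (outer x - outer y) \<le> 2" for x y :: "complex ^ 'm::finite"
proof -
  let ?c = "\<lambda>z :: complex ^ 'm. \<chi> j. cnj (z $ j)"
  have "row i (outer x - outer y) = (x $ i) *s ?c x - (y $ i) *s ?c y" for i
    by (simp add: row_def outer_def vec_eq_iff)
  moreover have "(x $ i) *s ?c x - (y $ i) *s ?c y \<in> vec.span {?c x, ?c y}" for i
    by (intro vec.span_diff vec.span_scale vec.span_base) auto
  ultimately have "rows (outer x - outer y) \<subseteq> vec.span {?c x, ?c y}"
    by (auto simp: rows_def)
  then have "rank (outer x - outer y) \<le> card {?c x, ?c y}"
    unfolding row_rank_def_gen by (rule vec.dim_le_card) simp
  also have "\<dots> \<le> 2"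
    by (simp add: card_insert_if)
  finally show ?thesis .
qed

text \<open>A phase cancels in every product \<open>x $ i * cnj (x $ j)\<close>; conversely these
  products fix \<open>x\<close> up to one common phase. Hence the lift is well defined and injective
  on the quotient by the circle.\<close>

lemma outer_eq_iff: "outer x = outer y \<longleftrightarrow> phase_rel x y"
proof
  assume "outer x = outer y"
  then have eq: "x $ i * cnj (x $ j) = y $ i * cnj (y $ j)" for i j
    by (simp add: outer_def vec_eq_iff)
  have norm_eq: "cmod (x $ i) = cmod (y $ i)" for i
    using eq[of i i] by (metis abs_norm_cancel complex_mod_mult_cnj norm_power power2_eq_iff_nonneg norm_ge_zero)
  show "phase_rel x y"
  proof (cases "x = 0")
    case True
    then have "y = 0"
      using norm_eq by (simp add: vec_eq_iff)
    with True show ?thesis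
      by (simp add: phase_rel_def)
  next
    case False
    then obtain k where k: "x $ k \<noteq> 0"
      by (auto simp: vec_eq_iff)
    then have yk: "y $ k \<noteq> 0"
      using norm_eq[of k] by auto
    \<comment> \<open>The phase is read off at the nonzero coordinate \<open>k\<close>: comparing
      the entries \<open>(i, k)\<close> gives \<open>y $ i = u * x $ i\<close> with the same
      \<open>u\<close> for every \<open>i\<close>.\<close>
    define u where "u = cnj (x $ k) / cnj (y $ k)"
    have "y $ i = u * x $ i" for i
      using eq[of i k] yk by (simp add: u_def field_simps)
    moreover have "cmod u = 1"
      using norm_eq[of k] yk by (simp add: u_def norm_divide)
    then have "u = exp (\<i> * complex_of_real (Arg u))"
      by (metis cis_Arg_unique cis_conv_exp cis_rcis_eq rcis_cmod_Arg mult_1 of_real_1 rcis_def)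
    ultimately show ?thesis
      unfolding phase_rel_def by (intro exI[of _ "Arg u"]) (auto simp: vec_eq_iff)
  qed
next
  assume "phase_rel x y"
  then obtain t :: real where "y = exp (\<i> * complex_of_real t) *s x"
    by (auto simp: phase_rel_def)
  moreover have "exp (\<i> * complex_of_real t) * cnj (exp (\<i> * complex_of_real t)) = 1"
    by (simp only: complex_norm_square[symmetric]) simp
  then have "(exp (\<i> * complex_of_real t) * a) * cnj (exp (\<i> * complex_of_real t) * b) = a * cnj b" for a b
    by (metis complex_cnj_mult mult.assoc mult.left_commute mult_1)
  ultimately show "outer x = outer y"
    by (simp add: outer_def vec_eq_iff)
qed

section \<open>Injectivity of the intensity map\<close>

text \<open>Passes from the quotient to representatives, where equality of classes becomes
  \<open>phase_rel\<close>; the squares disappear because moduli are nonnegative.\<close>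

lemma inj_intensity_map_iff_phase_rel:
  "inj (intensity_map \<phi>) \<longleftrightarrow>
    (\<forall>x y. (\<forall>n. cmod (cinner x (\<phi> n)) = cmod (cinner y (\<phi> n))) \<longrightarrow> phase_rel x y)"
proof -
  have "inj (intensity_map \<phi>) \<longleftrightarrow>
    (\<forall>p q. intensity_map \<phi> p = intensity_map \<phi> q \<longrightarrow> p = q)"
    by (auto simp: inj_def)
  also have "\<dots> \<longleftrightarrow> (\<forall>x y. (\<chi> n. (cmod (cinner x (\<phi> n)))\<^sup>2) = (\<chi> n. (cmod (cinner y (\<phi> n)))\<^sup>2)
      \<longrightarrow> phase_rel x y)"
    by transfer simp
  finally show ?thesis
    by (simp add: vec_eq_iff)
qed

text \<open>Two vectors have equal intensities exactly when the difference of their lifts satisfies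
  the linear conditions \<open>hform Q (\<phi> n) = 0\<close>. The frame property takes care of
  semidefinite solutions.\<close>

lemma inj_intensity_map_iff_hform:
  fixes \<phi> :: "'n::finite \<Rightarrow> complex ^ ('m::finite)"
  assumes frame: "complex_frame \<phi>"
  shows "inj (intensity_map \<phi>) \<longleftrightarrow>
    (\<forall>Q. hermitian Q \<and> rank Q \<le> 2 \<and> (\<forall>n. hform Q (\<phi> n) = 0) \<longrightarrow> Q = 0)"
    (is "?inj \<longleftrightarrow> ?Q")
proof
  assume ?inj
  then have inj: "outer x = outer y"
    if "\<And>n. cmod (cinner x (\<phi> n)) = cmod (cinner y (\<phi> n))" for x y
    using that by (simp add: inj_intensity_map_iff_phase_rel outer_eq_iff)
  \<comment> \<open>Semidefinite case: both nonnegative summands vanish at each frame vector, and a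
    vector orthogonal to the frame is zero.\<close>
  have pos: "a *\<^sub>R outer x + b *\<^sub>R outer y = 0"
    if "\<And>n. a * (cmod (cinner x (\<phi> n)))\<^sup>2 + b * (cmod (cinner y (\<phi> n)))\<^sup>2 = 0"
      and "0 \<le> a" "0 \<le> b" for a b x y
  proof -
    have "a * (cmod (cinner x (\<phi> n)))\<^sup>2 = 0 \<and> b * (cmod (cinner y (\<phi> n)))\<^sup>2 = 0" for n
      using that(1)[of n] that(2,3) by (simp add: add_nonneg_eq_0_iff)
    then have "(a = 0 \<or> x = 0) \<and> (b = 0 \<or> y = 0)"
      using cinner_eq_0_on_frame[OF frame] by auto
    then show ?thesis
      by (auto simp: outer_def vec_eq_iff)
  qed
  \<comment> \<open>Opposite signs: \<open>sqrt a *\<^sub>R x\<close> and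
    \<open>sqrt (- b) *\<^sub>R y\<close> have the same intensities, so by injectivity their lifts
    agree and the two terms cancel.\<close>
  have mixed: "a *\<^sub>R outer x + b *\<^sub>R outer y = 0"
    if "\<And>n. a * (cmod (cinner x (\<phi> n)))\<^sup>2 + b * (cmod (cinner y (\<phi> n)))\<^sup>2 = 0"
      and "0 \<le> a" "b \<le> 0" for a b x y
  proof -
    have scale: "(cmod (cinner (c *\<^sub>R z) v))\<^sup>2 = c\<^sup>2 * (cmod (cinner z v))\<^sup>2"
      for c and z v :: "complex ^ 'm"
    proof -
      have "cinner (c *\<^sub>R z) v = complex_of_real c * cinner z v"
        by (simp add: cinner_def sum_distrib_left scaleR_conv_of_real[where 'a = complex] mult.assoc)
      then show ?thesis
        by (simp add: norm_mult power_mult_distrib)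
    qed
    have "(cmod (cinner (sqrt a *\<^sub>R x) (\<phi> n)))\<^sup>2 = (cmod (cinner (sqrt (- b) *\<^sub>R y) (\<phi> n)))\<^sup>2" for n
      using that(1)[of n] that(2,3) by (simp add: scale)
    then have "outer (sqrt a *\<^sub>R x) = outer (sqrt (- b) *\<^sub>R y)"
      by (intro inj) simp
    then show ?thesis
      using that(2,3) by (simp add: outer_scaleR)
  qed
  show ?Q
  proof (intro allI impI, elim conjE)
    fix Q assume Q: "hermitian Q" "rank Q \<le> 2" and vanish: "\<forall>n. hform Q (\<phi> n) = 0"
    obtain a b x y where Q_eq: "Q = a *\<^sub>R outer x + b *\<^sub>R outer y"
      using hermitian_rank_le_2[OF Q] .
    have zero: "a * (cmod (cinner x (\<phi> n)))\<^sup>2 + b * (cmod (cinner y (\<phi> n)))\<^sup>2 = 0" for n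
    proof -
      have "complex_of_real (a * (cmod (cinner x (\<phi> n)))\<^sup>2 + b * (cmod (cinner y (\<phi> n)))\<^sup>2)
        = hform Q (\<phi> n)"
        by (simp add: Q_eq hform_add hform_scaleR hform_outer)
      then show ?thesis
        using vanish by (metis of_real_eq_0_iff)
    qed
    \<comment> \<open>The cases overlap where a coefficient is zero. The second follows from
      \<open>pos\<close> applied to \<open>- Q\<close>, the fourth from \<open>mixed\<close> with
      the summands exchanged.\<close>
    consider "0 \<le> a" "0 \<le> b" | "a \<le> 0" "b \<le> 0" | "0 \<le> a" "b \<le> 0" | "a \<le> 0" "0 \<le> b"
      by linarith
    then show "Q = 0"
    proof cases
      case 1
      then show ?thesis
        using pos[of a x b y] zero by (simp add: Q_eq)
    next
      case 2
      have "(- a) * (cmod (cinner x (\<phi> n)))\<^sup>2 + (- b) * (cmod (cinner y (\<phi> n)))\<^sup>2 = 0" for n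
        using zero[of n] by linarith
      then have "(- a) *\<^sub>R outer x + (- b) *\<^sub>R outer y = 0"
        by (rule pos) (use 2 in simp_all)
      then have "- Q = 0"
        by (simp add: Q_eq)
      then show ?thesis
        by simp
    next
      case 3
      then show ?thesis
        using mixed[of a x b y] zero by (simp add: Q_eq)
    next
      case 4
      then show ?thesis
        using mixed[of b y a x] zero by (simp add: Q_eq add.commute)
    qed
  qed
next
  assume Q: ?Q
  show ?inj
    unfolding inj_intensity_map_iff_phase_rel
  proof (intro allI impI)
    fix x y assume eq: "\<forall>n. cmod (cinner x (\<phi> n)) = cmod (cinner y (\<phi> n))"
    have "hform (outer x - outer y) (\<phi> n) = 0" for n
      using eq by (simp add: hform_diff hform_outer)
    then have "outer x - outer y = 0"
      using Q hermitian_diff[OF hermitian_outer hermitian_outer] rank_outer_diff_le by blast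
    then show "phase_rel x y"
      by (simp add: outer_eq_iff)
  qed
qed

section \<open>Real points of the incidence variety\<close>

abbreviation complexify :: "real ^ 'k ^ 'm \<Rightarrow> complex ^ 'k ^ 'm" where
  "complexify \<equiv> map_matrix complex_of_real"

text \<open>Compare real and imaginary parts of the entries at \<open>(i, j)\<close> and
  \<open>(j, i)\<close>: conjugation fixes those of \<open>X\<close> and negates those of
  \<open>Y\<close>.\<close>

lemma hermitian_complexify_iff:
  "hermitian (complexify X + map_matrix ((*) \<i>) (complexify Y)) \<longleftrightarrow>
    complexify X \<in> sym_mats \<and> complexify Y \<in> skew_mats"
proof -
  have "hermitian (complexify X + map_matrix ((*) \<i>) (complexify Y)) \<longleftrightarrow>
      (\<forall>i j. X $ j $ i = X $ i $ j \<and> Y $ j $ i = - Y $ i $ j)"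
    by (simp add: hermitian_def complex_eq_iff)
  moreover have "complexify X \<in> sym_mats \<longleftrightarrow> (\<forall>i j. X $ j $ i = X $ i $ j)"
    by (simp add: sym_mats_def vec_eq_iff transpose_def)
  moreover have "complexify Y \<in> skew_mats \<longleftrightarrow> (\<forall>i j. Y $ j $ i = - Y $ i $ j)"
    by (simp add: skew_mats_def vec_eq_iff transpose_def flip: of_real_minus)
  ultimately show ?thesis
    by blast
qed

text \<open>Expanding the form at \<open>u + \<i> v\<close> gives eight bilinear terms. Symmetry of
  \<open>X\<close> cancels its two mixed terms; skewness of \<open>Y\<close> kills its two pure
  terms and merges its mixed ones, whence the factor 2.\<close>

lemma hform_complexify:
  fixes X Y :: "real ^ 'm ^ ('m::finite)"
  assumes "complexify X \<in> sym_mats" "complexify Y \<in> skew_mats"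
  shows "hform (complexify X + map_matrix ((*) \<i>) (complexify Y))
      (\<chi> i. complex_of_real (u $ i) + \<i> * complex_of_real (v $ i)) =
    scalar_product (\<chi> i. complex_of_real (u $ i)) (complexify X *v (\<chi> i. complex_of_real (u $ i)))
    + scalar_product (\<chi> i. complex_of_real (v $ i)) (complexify X *v (\<chi> i. complex_of_real (v $ i)))
    - 2 * scalar_product (\<chi> i. complex_of_real (u $ i)) (complexify Y *v (\<chi> i. complex_of_real (v $ i)))"
proof -
  let ?B = "\<lambda>(A :: complex ^ 'm ^ 'm) x y. scalar_product x (A *v y)"
  let ?X = "complexify X" and ?Y = "complexify Y"
  let ?u = "(\<chi> i. complex_of_real (u $ i)) :: complex ^ 'm"
  let ?v = "(\<chi> i. complex_of_real (v $ i)) :: complex ^ 'm"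
  have B_transpose: "?B A x y = ?B (transpose A) y x" for A x y
  proof -
    have "?B A x y = (\<Sum>i\<in>UNIV. \<Sum>j\<in>UNIV. x $ i * (A $ i $ j * y $ j))"
      by (simp add: scalar_product_def matrix_vector_mult_def sum_distrib_left)
    also have "\<dots> = (\<Sum>j\<in>UNIV. \<Sum>i\<in>UNIV. x $ i * (A $ i $ j * y $ j))"
      by (rule sum.swap)
    also have "\<dots> = ?B (transpose A) y x"
      by (simp add: scalar_product_def matrix_vector_mult_def sum_distrib_left transpose_def mult_ac)
    finally show ?thesis .
  qed
  have B_neg: "?B (- A) x y = - ?B A x y" for A x y
    by (simp add: scalar_product_def matrix_vector_mult_def sum_negf)
  have X: "?B ?X ?v ?u = ?B ?X ?u ?v"
    using B_transpose[of ?v ?X ?u] assms(1) unfolding sym_mats_def mem_Collect_eq by metis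
  have Y: "?B ?Y x y = - ?B ?Y y x" for x y
    using B_transpose[of x ?Y y] B_neg[of y ?Y x] assms(2) unfolding skew_mats_def mem_Collect_eq by metis
  have Y0: "?B ?Y x x = 0" for x
    using Y[of x x] by simp
  have mult_vec: "(\<Sum>j\<in>UNIV. (?X $ i $ j + \<i> * ?Y $ i $ j) * (?u $ j + \<i> * ?v $ j)) =
      (?X *v ?u) $ i + \<i> * (?X *v ?v) $ i + \<i> * (?Y *v ?u) $ i - (?Y *v ?v) $ i" for i
    unfolding matrix_vector_mult_def vec_lambda_beta sum_distrib_left
    unfolding sum.distrib[symmetric] sum_subtractf[symmetric]
    by (rule sum.cong) (simp_all add: algebra_simps)
  \<comment> \<open>Since \<open>u\<close> and \<open>v\<close> are real, the conjugated argument of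
    \<open>cinner\<close> has the coordinates \<open>?u $ i - \<i> * ?v $ i\<close>.\<close>
  have "hform (?X + map_matrix ((*) \<i>) ?Y) (\<chi> i. complex_of_real (u $ i) + \<i> * complex_of_real (v $ i))
      = (\<Sum>i\<in>UNIV. (?u $ i - \<i> * ?v $ i) * (\<Sum>j\<in>UNIV. (?X $ i $ j + \<i> * ?Y $ i $ j) * (?u $ j + \<i> * ?v $ j)))"
    by (simp add: hform_def cinner_def matrix_vector_mult_def mult.commute)
  also have "\<dots> = (\<Sum>i\<in>UNIV. (?u $ i - \<i> * ?v $ i) *
      ((?X *v ?u) $ i + \<i> * (?X *v ?v) $ i + \<i> * (?Y *v ?u) $ i - (?Y *v ?v) $ i))"
    unfolding mult_vec ..
  also have "\<dots> = ?B ?X ?u ?u + \<i> * ?B ?X ?u ?v + \<i> * ?B ?Y ?u ?u - ?B ?Y ?u ?v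
      - \<i> * ?B ?X ?v ?u + ?B ?X ?v ?v + ?B ?Y ?v ?u + \<i> * ?B ?Y ?v ?v"
    unfolding scalar_product_def sum_distrib_left
    unfolding sum.distrib[symmetric] sum_subtractf[symmetric]
    by (rule sum.cong) (simp_all add: algebra_simps)
  also have "\<dots> = ?B ?X ?u ?u + ?B ?X ?v ?v - 2 * ?B ?Y ?u ?v"
    by (simp add: X Y0 Y[of ?v ?u])
  finally show ?thesis .
qed

section \<open>Representatives of projective points\<close>

lemma proj_pt_eqD:
  assumes "proj_pt p = proj_pt q"
  obtains c where "c \<noteq> 0" "p = pair_scale c q"
proof -
  have "p = pair_scale 1 p"
    by (simp add: pair_scale_def prod_eq_iff vec_eq_iff)
  then have "p \<in> proj_pt p"
    unfolding proj_pt_def mem_Collect_eq by (intro exI[of _ 1] conjI one_neq_zero)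
  then have "p \<in> proj_pt q"
    by (simp only: assms)
  then show ?thesis
    unfolding proj_pt_def using that by blast
qed

lemma pair_scale_eq_0_iff: "c \<noteq> 0 \<Longrightarrow> pair_scale c q = 0 \<longleftrightarrow> q = 0"
  by (simp add: pair_scale_def prod_eq_iff vec_eq_iff)

lemma pair_scale_sym_skew:
  assumes "q \<in> sym_mats \<times> skew_mats"
  shows "pair_scale c q \<in> sym_mats \<times> skew_mats"
proof -
  have "transpose (map_matrix ((*) c) A) = map_matrix ((*) c) (transpose A)"
    "map_matrix ((*) c) (- A) = - map_matrix ((*) c) A" for A :: "complex ^ 'a ^ 'a"
    by (simp_all add: vec_eq_iff transpose_def)
  then show ?thesis
    using assms by (simp add: pair_scale_def mem_Times_iff sym_mats_def skew_mats_def)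
qed

text \<open>Equal points have proportional representatives, and both the symmetric-skew condition
  and being nonzero survive scaling. What holds for one representative thus holds for all.\<close>

lemma proj_pt_mem_proj_space_iff:
  "proj_pt q \<in> proj_space (sym_mats \<times> skew_mats) \<longleftrightarrow> q \<in> sym_mats \<times> skew_mats \<and> q \<noteq> 0"
proof
  assume "proj_pt q \<in> proj_space (sym_mats \<times> skew_mats)"
  then obtain r where r: "r \<in> sym_mats \<times> skew_mats" "r \<noteq> 0" "proj_pt q = proj_pt r"
    unfolding proj_space_def by blast
  obtain c where "c \<noteq> 0" "q = pair_scale c r"
    using r(3) by (rule proj_pt_eqD)
  then show "q \<in> sym_mats \<times> skew_mats \<and> q \<noteq> 0"
    using r(1,2) by (simp only: pair_scale_sym_skew pair_scale_eq_0_iff simp_thms)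
next
  assume "q \<in> sym_mats \<times> skew_mats \<and> q \<noteq> 0"
  then show "proj_pt q \<in> proj_space (sym_mats \<times> skew_mats)"
    unfolding proj_space_def by blast
qed

lemma mem_real_pairs_iff: "q \<in> real_pairs \<longleftrightarrow> (\<exists>X Y. q = (complexify X, complexify Y))"
proof
  assume "q \<in> real_pairs"
  then obtain r where "q = map_prod complexify complexify r"
    unfolding real_pairs_def by (rule rangeE)
  then show "\<exists>X Y. q = (complexify X, complexify Y)"
    by (cases r) (simp only: map_prod_simp, blast)
next
  assume "\<exists>X Y. q = (complexify X, complexify Y)"
  then obtain X Y where "q = map_prod complexify complexify (X, Y)"
    by (auto simp only: map_prod_simp)
  then show "q \<in> real_pairs"
    unfolding real_pairs_def by (rule range_eqI)
qed

text \<open>The equations are homogeneous in each factor, so they may be tested on the given real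
  representative of the first point and on any real representative of the second.\<close>

lemma proj_pt_mem_fst_BMN_real_iff:
  fixes U V :: "real ^ 'n::finite ^ 'm::finite"
  assumes "(complexify U, complexify V) \<noteq> 0"
  shows "proj_pt (complexify U, complexify V) \<in> fst ` BMN_real \<longleftrightarrow>
    (\<exists>X Y. (complexify X, complexify Y) \<noteq> 0 \<and> complexify X \<in> sym_mats \<and> complexify Y \<in> skew_mats \<and>
      BMN_eqs (complexify U, complexify V) (complexify X, complexify Y))"
proof -
  let ?p = "(complexify U, complexify V)"
  have p: "?p \<in> real_pairs"
    unfolding mem_real_pairs_iff by blast
  \<comment> \<open>The side conditions on \<open>q\<close> move into the equivalence: when they
    fail, \<open>proj_pt q\<close> is not a point of the second projective space.\<close>
  have BMN: "(proj_pt ?p, proj_pt q) \<in> BMN \<longleftrightarrow>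
      q \<noteq> 0 \<and> q \<in> sym_mats \<times> skew_mats \<and> BMN_eqs ?p q" for q
  proof (cases "q \<noteq> 0 \<and> q \<in> sym_mats \<times> skew_mats")
    case True
    then show ?thesis
      using BMN_iff[OF assms] by blast
  next
    case False
    then have "proj_pt q \<notin> proj_space (sym_mats \<times> skew_mats)"
      unfolding proj_pt_mem_proj_space_iff by blast
    then have "(proj_pt ?p, proj_pt q) \<notin> BMN"
      unfolding BMN_def mem_Collect_eq case_prod_conv mem_Sigma_iff by blast
    with False show ?thesis
      by blast
  qed
  have "proj_pt ?p \<in> fst ` BMN_real \<longleftrightarrow> (\<exists>Q. (proj_pt ?p, Q) \<in> BMN_real)"
    by (simp only: image_iff Bex_def split_paired_Ex fst_conv) blast
  \<comment> \<open>The pair \<open>?p\<close> itself witnesses that the first point is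
    real.\<close>
  also have "\<dots> \<longleftrightarrow> (\<exists>q\<in>real_pairs. (proj_pt ?p, proj_pt q) \<in> BMN)"
    unfolding BMN_real_def mem_Collect_eq case_prod_conv using p by blast
  also have "\<dots> \<longleftrightarrow> (\<exists>X Y. (proj_pt ?p, proj_pt (complexify X, complexify Y)) \<in> BMN)"
    unfolding Bex_def mem_real_pairs_iff by blast
  finally show ?thesis
    unfolding BMN mem_Sigma_iff conj_assoc .
qed

theorem proposition3p3:
  fixes \<phi> :: "'n::finite \<Rightarrow> complex ^ ('m::finite)"
    and U V :: "real ^ 'n ^ 'm"
  assumes "complex_frame \<phi>"
    and "\<And>n. \<phi> n = (\<chi> i. complex_of_real (column n U $ i) + \<i> * complex_of_real (column n V $ i))"
  shows "inj (intensity_map \<phi>) \<longleftrightarrow>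
    proj_pt (map_matrix complex_of_real U, map_matrix complex_of_real V) \<notin> fst ` BMN_real"
proof -
  let ?p = "(complexify U, complexify V)"
  let ?H = "\<lambda>X Y. complexify X + map_matrix ((*) \<i>) (complexify Y) :: complex ^ 'm ^ 'm"
  have "?p \<noteq> 0"
  proof
    assume "?p = 0"
    then have "\<phi> n = 0" for n
      by (simp add: assms(2) vec_eq_iff prod_eq_iff column_def)
    \<comment> \<open>If all frame vectors vanish, every vector is orthogonal to the frame, in
      particular the all-ones vector, which is nonzero as the index type is nonempty.\<close>
    then have "(1 :: complex ^ 'm) = 0"
      by (intro cinner_eq_0_on_frame[OF assms(1)]) (simp add: cinner_def)
    then show False
      by simp
  qed
  have eqs: "BMN_eqs ?p (complexify X, complexify Y) \<longleftrightarrow>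
      rank (?H X Y) \<le> 2 \<and> (\<forall>n. hform (?H X Y) (\<phi> n) = 0)"
    if "complexify X \<in> sym_mats" "complexify Y \<in> skew_mats" for X Y :: "real ^ 'm ^ 'm"
  proof -
    have "column n (complexify A) = (\<chi> i. complex_of_real (column n A $ i))"
      for n and A :: "real ^ 'n ^ 'm"
      by (simp add: column_def vec_eq_iff)
    then show ?thesis
      unfolding BMN_eqs_def case_prod_conv assms(2) hform_complexify[OF that] by simp
  qed
  \<comment> \<open>Splitting entries into real and imaginary parts lets a quantifier over complex
    \<open>Q\<close> become one over real \<open>X\<close> and \<open>Y\<close>.\<close>
  have ex_H: "\<exists>X Y. Q = ?H X Y" for Q
    by (intro exI[of _ "map_matrix Re Q"] exI[of _ "map_matrix Im Q"])
      (simp add: vec_eq_iff complex_eq_iff)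
  \<comment> \<open>A nonzero \<open>Q\<close> is therefore the same as a pair \<open>(X, Y)\<close>
    that defines a projective point.\<close>
  have H_0: "?H X Y = 0 \<longleftrightarrow> (complexify X, complexify Y) = 0" for X Y
    by (auto simp: vec_eq_iff complex_eq_iff prod_eq_iff)
  have "inj (intensity_map \<phi>) \<longleftrightarrow>
    (\<forall>X Y. hermitian (?H X Y) \<and> rank (?H X Y) \<le> 2 \<and> (\<forall>n. hform (?H X Y) (\<phi> n) = 0)
      \<longrightarrow> ?H X Y = 0)"
    unfolding inj_intensity_map_iff_hform[OF assms(1)] using ex_H by metis
  also have "\<dots> \<longleftrightarrow> proj_pt ?p \<notin> fst ` BMN_real"
    unfolding proj_pt_mem_fst_BMN_real_iff[OF \<open>?p \<noteq> 0\<close>] hermitian_complexify_iff H_0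
    using eqs by blast
  finally show ?thesis .
qed

end
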